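(* For every $\delta\in(0,1)$ there is a constant $C=C(\delta)>0$ such that the following holds. Let $N\ge1$ and $k\ge1$ be integers and let $p\in(0,1)$. Then for every integer $m\ge\exp\big(C(N/p)^{1/3}\big)$ there is an algorithm (an estimator depending only on $k,N,p,m$) such that for every choice of distinct $r_1,\dots,r_k\in\{1,2,\dots,N\}$, when given $m$ independent samples from the uniform mixture $\mathcal{M}=\frac1k\sum_{i=1}^k\mathrm{NB}(r_i,p)$, it outputs exactly the set $\{r_1,\dots,r_k\}$ with probability at least $1-\delta$.
   Context: $\mathrm{NB}(r,p)$ is the negative binomial distribution with pmf $\binom{x+r-1}{x}(1-p)^rp^x$ on $x\in\{0,1,2,\dots\}$. The mixture $\frac1k\sum_i f_i$ is the distribution whose pmf is the average of the pmfs of its components. The parameter $p$ is shared by all components and known. *)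

theory Defs
  imports "HOL-Probability.Probability"
begin

(* The library's negative binomial counts failures and takes the success probability as its
   argument, whereas the parameter p here is the one raised to the power x. *)
definition NB :: "nat \<Rightarrow> real \<Rightarrow> nat pmf" where
  "NB r p = neg_binomial_pmf r (1 - p)"

lemma pmf_NB:
  assumes "0 < p" "p < 1"
  shows "pmf (NB r p) x = real ((x + r - 1) choose x) * (1 - p) ^ r * p ^ x"
  using assms by (simp add: NB_def pmf_neg_binomial)

definition uniform_mixture :: "nat \<Rightarrow> (nat \<Rightarrow> 'a pmf) \<Rightarrow> 'a pmf" where
  "uniform_mixture k f = bind_pmf (pmf_of_set {1..k}) f"

lemma pmf_uniform_mixture:
  assumes "1 \<le> k"
  shows "pmf (uniform_mixture k f) x = (1 / real k) * (\<Sum>i = 1..k. pmf (f i) x)"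
  using assms by (simp add: uniform_mixture_def pmf_bind_pmf_of_set)

end

theory Submission
  imports Defs "HOL-Complex_Analysis.Complex_Analysis"
begin

text \<open>
  Two mixtures with parameter sets \<open>S \<noteq> S'\<close> have generating functions whose difference at
  \<open>z\<close> is \<open>A w / k\<close>, where \<open>w = (1 - p) / (1 - p z)\<close> and
  \<open>A\<close> is a polynomial with coefficients in \<open>{-1, 0, 1}\<close>. By Cauchy-Schwarz,
  \<open>\<bar>A w / k\<bar>\<^sup>2\<close> is at most the squared Hellinger distance times four
  times the larger second moment \<open>E (\<bar>z\<bar>\<^sup>2 ^ X)\<close>.
  Put \<open>L = (N / p) powr (1 / 3)\<close>. On an arc of length about \<open>1 / L\<close> at
  \<open>w = 1\<close> the polynomial reaches \<open>exp (- O(L))\<close> (Borwein and Erdelyi), while the second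
  moment is at most \<open>exp (O(N / (p L\<^sup>2))) = exp (O(L))\<close>. The second moment may be infinite
  on this arc if \<open>N\<^sup>2 p < 1\<close>; then an arc of length \<open>1 / N\<close> is used, and the
  large value there is carried to a disc of smaller radius by comparing the growth of polynomials
  of degree \<open>N\<close>. So all Hellinger distances are at least \<open>exp (- O(L))\<close>, and
  the maximum likelihood estimator over the at most \<open>2 ^ N\<close> candidate sets succeeds,
  since it prefers a given wrong candidate with probability at most the \<open>m\<close>-th power of the
  Bhattacharyya coefficient.
\<close>

section \<open>Maximum likelihood and the Bhattacharyya coefficient\<close>

definition bhattacharyya :: "nat pmf \<Rightarrow> nat pmf \<Rightarrow> real" where
  "bhattacharyya P Q = (\<Sum>x. sqrt (pmf P x * pmf Q x))"

definition likelihood :: "'a pmf \<Rightarrow> 'a list \<Rightarrow> real" where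
  "likelihood P xs = prod_list (map (pmf P) xs)"

lemma likelihood_Nil [simp]: "likelihood P [] = 1"
  and likelihood_Cons [simp]: "likelihood P (x # xs) = pmf P x * likelihood P xs"
  by (simp_all add: likelihood_def)

lemma likelihood_nonneg [simp]: "0 \<le> likelihood P xs"
  by (induction xs) auto

lemma likelihood_pos: "xs \<in> lists (set_pmf P) \<Longrightarrow> 0 < likelihood P xs"
  by (induction xs) (auto simp: set_pmf_iff intro!: mult_pos_pos pmf_pos)

lemma pmf_nat_sums_1: "pmf (P :: nat pmf) sums 1"
proof -
  have "(\<Sum>x. ennreal (pmf P x)) = 1"
    using nn_integral_pmf_eq_1[of P] by (simp add: nn_integral_count_space_nat)
  moreover from this have "summable (pmf P)"
    by (intro summable_suminf_not_top) auto
  ultimately show ?thesis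
    by (simp add: suminf_ennreal2 sums_iff)
qed

lemma summable_sqrt_pmf_mult: "summable (\<lambda>x. sqrt (pmf P x * pmf Q (x::nat)))"
proof (rule summable_comparison_test'[where N = 0 and g = "\<lambda>x. (pmf P x + pmf Q x) / 2"])
  show "summable (\<lambda>x. (pmf P x + pmf Q x) / 2)"
    using pmf_nat_sums_1[of P] pmf_nat_sums_1[of Q]
    by (intro summable_divide summable_add) (auto simp: sums_iff)
qed (use arith_geo_mean_sqrt in \<open>auto simp: pmf_nonneg\<close>)

lemma bhattacharyya_nonneg: "0 \<le> bhattacharyya P Q"
  unfolding bhattacharyya_def by (intro suminf_nonneg summable_sqrt_pmf_mult) auto

text \<open>Weighting the ratio by \<open>pmf P x\<close> gives
  \<open>sqrt (pmf P x * pmf Q x)\<close>; where \<open>pmf P x = 0\<close> both expressions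
  vanish.\<close>

lemma nn_integral_sqrt_likelihood_ratio:
  "(\<integral>\<^sup>+x. ennreal (sqrt (pmf Q x / pmf P x)) \<partial>measure_pmf P) \<le> ennreal (bhattacharyya P Q)"
proof -
  have "pmf P x * sqrt (pmf Q x / pmf P x) \<le> sqrt (pmf P x * pmf Q x)" for x
    by (cases "pmf P x = 0") (auto simp: real_sqrt_divide real_sqrt_mult field_simps
          simp flip: mult.assoc)
  then have "(\<integral>\<^sup>+x. ennreal (sqrt (pmf Q x / pmf P x)) \<partial>measure_pmf P)
      \<le> (\<Sum>x. ennreal (sqrt (pmf P x * pmf Q x)))"
    unfolding nn_integral_measure_pmf nn_integral_count_space_nat
    by (intro suminf_le) (auto simp flip: ennreal_mult)
  also have "\<dots> = ennreal (bhattacharyya P Q)"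
    unfolding bhattacharyya_def by (intro suminf_ennreal2 summable_sqrt_pmf_mult) auto
  finally show ?thesis .
qed

text \<open>The samples are independent and the likelihood ratio is a product, so each further
  sample contributes one more factor of at most \<open>bhattacharyya P Q\<close>.\<close>

lemma nn_integral_sqrt_likelihood_ratio_replicate:
  "(\<integral>\<^sup>+xs. ennreal (sqrt (likelihood Q xs / likelihood P xs)) \<partial>measure_pmf (replicate_pmf m P))
    \<le> ennreal (bhattacharyya P Q ^ m)"
proof (induction m)
  case (Suc m)
  let ?b = "bhattacharyya P Q"
  let ?R = "\<lambda>xs. ennreal (sqrt (likelihood Q xs / likelihood P xs))"
  let ?r = "\<lambda>x. ennreal (sqrt (pmf Q x / pmf P x))"
  have "?R (x # xs) = ?r x * ?R xs" for x xs
    by (simp add: real_sqrt_mult real_sqrt_divide flip: ennreal_mult)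
  then have "(\<integral>\<^sup>+xs. ?R xs \<partial>measure_pmf (replicate_pmf (Suc m) P))
      = (\<integral>\<^sup>+x. ?r x * (\<integral>\<^sup>+xs. ?R xs \<partial>measure_pmf (replicate_pmf m P)) \<partial>measure_pmf P)"
    by (simp add: nn_integral_cmult)
  also have "\<dots> \<le> (\<integral>\<^sup>+x. ?r x * ennreal (?b ^ m) \<partial>measure_pmf P)"
    by (intro nn_integral_mono mult_left_mono Suc.IH) auto
  also have "\<dots> = (\<integral>\<^sup>+x. ?r x \<partial>measure_pmf P) * ennreal (?b ^ m)"
    by (simp add: nn_integral_multc)
  also have "\<dots> \<le> ennreal ?b * ennreal (?b ^ m)"
    by (intro mult_right_mono nn_integral_sqrt_likelihood_ratio) auto
  finally show ?case
    by (simp add: bhattacharyya_nonneg flip: ennreal_mult)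
qed simp

text \<open>Markov's inequality for the square root of the likelihood ratio, which is at least 1 on
  the event. The division is sound because \<open>likelihood P xs\<close> is positive almost surely
  under \<open>P\<close>.\<close>

lemma prob_likelihood_le:
  "measure_pmf.prob (replicate_pmf m P) {xs. likelihood P xs \<le> likelihood Q xs}
    \<le> bhattacharyya P Q ^ m"
proof -
  let ?M = "measure_pmf (replicate_pmf m P)"
  let ?E = "{xs. likelihood P xs \<le> likelihood Q xs}"
  have "emeasure ?M ?E = (\<integral>\<^sup>+xs. indicator ?E xs \<partial>?M)"
    by simp
  also have "\<dots> \<le> (\<integral>\<^sup>+xs. ennreal (sqrt (likelihood Q xs / likelihood P xs)) \<partial>?M)"
    by (intro nn_integral_mono_AE)
       (auto simp: AE_measure_pmf_iff set_replicate_pmf indicator_def dest!: likelihood_pos)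
  also have "\<dots> \<le> ennreal (bhattacharyya P Q ^ m)"
    by (rule nn_integral_sqrt_likelihood_ratio_replicate)
  finally show ?thesis
    by (simp add: measure_pmf.emeasure_eq_measure bhattacharyya_nonneg)
qed

text \<open>Union bound over the wrong hypotheses; ties are counted as errors. The estimator
  maximises the likelihood, written as \<open>arg_min_on\<close> of its negative, and is obtained
  before \<open>m\<close>, \<open>\<beta>\<close> and the true hypothesis \<open>h\<close> are
  fixed.\<close>

lemma ex_maximum_likelihood_estimator:
  assumes "finite H"
  obtains est :: "nat list \<Rightarrow> 'h" where
    "\<And>m \<beta> h. h \<in> H \<Longrightarrow> 0 \<le> \<beta> \<Longrightarrow>
       (\<And>h'. h' \<in> H \<Longrightarrow> h' \<noteq> h \<Longrightarrow> bhattacharyya (P h) (P h') \<le> \<beta>) \<Longrightarrow>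
       1 - real (card H) * \<beta> ^ m \<le> measure_pmf.prob (replicate_pmf m (P h)) {xs. est xs = h}"
proof
  let ?est = "\<lambda>xs. arg_min_on (\<lambda>h. - likelihood (P h) xs) H"
  fix m \<beta> h
  assume h: "h \<in> H" and \<beta>: "0 \<le> \<beta>"
    and b: "\<And>h'. h' \<in> H \<Longrightarrow> h' \<noteq> h \<Longrightarrow> bhattacharyya (P h) (P h') \<le> \<beta>"
  let ?M = "measure_pmf (replicate_pmf m (P h))"
  let ?E = "\<lambda>h'. {xs. likelihood (P h) xs \<le> likelihood (P h') xs}"
  have est: "?est xs \<in> H" "likelihood (P h) xs \<le> likelihood (P (?est xs)) xs" for xs
    using arg_min_if_finite(1)[of H "\<lambda>h. - likelihood (P h) xs"]
      arg_min_least[of H h "\<lambda>h. - likelihood (P h) xs"] assms h by auto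
  have "measure ?M (- {xs. ?est xs = h}) \<le> measure ?M (\<Union>h'\<in>H - {h}. ?E h')"
    by (intro measure_pmf.finite_measure_mono) (use est in auto)
  also have "\<dots> \<le> (\<Sum>h'\<in>H - {h}. measure ?M (?E h'))"
    using assms by (intro measure_pmf.finite_measure_subadditive_finite) auto
  also have "\<dots> \<le> (\<Sum>h'\<in>H - {h}. \<beta> ^ m)"
    by (intro sum_mono order_trans[OF prob_likelihood_le] power_mono b bhattacharyya_nonneg) auto
  also have "\<dots> \<le> real (card H) * \<beta> ^ m"
    using assms \<beta> h by (auto intro!: mult_right_mono card_mono)
  finally show "1 - real (card H) * \<beta> ^ m \<le> measure ?M {xs. ?est xs = h}"
    using measure_pmf.prob_compl[of "{xs. ?est xs = h}" "replicate_pmf m (P h)"]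
    by (simp add: Compl_eq_Diff_UNIV)
qed

section \<open>Generating functions and the Hellinger distance\<close>

text \<open>Factor \<open>pmf P x - pmf Q x\<close> as (sqrt P - sqrt Q)(sqrt P + sqrt Q) and apply
  Cauchy-Schwarz. The first factors have square sum \<open>2 - 2 * bhattacharyya P Q\<close>; the
  second, weighted by \<open>norm z ^ x\<close>, have square sum at most
  \<open>4 * B\<close>.\<close>

lemma pgf_diff_le_hellinger:
  fixes P Q :: "nat pmf" and z D :: complex
  assumes "(\<lambda>x. pmf P x * (norm z)\<^sup>2 ^ x) sums BP" "(\<lambda>x. pmf Q x * (norm z)\<^sup>2 ^ x) sums BQ"
    and "BP \<le> B" "BQ \<le> B"
    and D: "(\<lambda>x. of_real (pmf P x - pmf Q x) * z ^ x) sums D"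
  shows "(norm D)\<^sup>2 \<le> 4 * B * (2 - 2 * bhattacharyya P Q)"
proof -
  define t where "t = norm z"
  define h where "h = 2 - 2 * bhattacharyya P Q"
  have "(\<lambda>x. (sqrt (pmf P x) - sqrt (pmf Q x))\<^sup>2) sums h"
  proof -
    have "(\<lambda>x. pmf P x + pmf Q x - 2 * sqrt (pmf P x * pmf Q x)) sums (1 + 1 - 2 * bhattacharyya P Q)"
      unfolding bhattacharyya_def
      by (intro sums_diff sums_add pmf_nat_sums_1 sums_mult summable_sums summable_sqrt_pmf_mult)
    then show ?thesis
      by (simp add: power2_diff real_sqrt_mult h_def algebra_simps)
  qed
  then have h: "(\<Sum>x<n. (sqrt (pmf P x) - sqrt (pmf Q x))\<^sup>2) \<le> h" for n
    using sum_le_suminf[of "\<lambda>x. (sqrt (pmf P x) - sqrt (pmf Q x))\<^sup>2" "{..<n}"]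
    by (auto simp: sums_iff)
  have B: "(\<Sum>x<n. ((sqrt (pmf P x) + sqrt (pmf Q x)) * t ^ x)\<^sup>2) \<le> 4 * B" for n
  proof -
    have "((sqrt (pmf P x) + sqrt (pmf Q x)) * t ^ x)\<^sup>2
        \<le> 2 * (pmf P x * t\<^sup>2 ^ x) + 2 * (pmf Q x * t\<^sup>2 ^ x)" for x
    proof -
      have "(sqrt (pmf P x) + sqrt (pmf Q x))\<^sup>2 \<le> 2 * pmf P x + 2 * pmf Q x"
        using sum_squares_bound[of "sqrt (pmf P x)" "sqrt (pmf Q x)"] by (simp add: power2_sum)
      then have "(sqrt (pmf P x) + sqrt (pmf Q x))\<^sup>2 * (t ^ x)\<^sup>2 \<le> (2 * pmf P x + 2 * pmf Q x) * (t ^ x)\<^sup>2"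
        by (intro mult_right_mono) auto
      moreover have "(t ^ x)\<^sup>2 = t\<^sup>2 ^ x"
        by (simp add: mult.commute flip: power_mult)
      ultimately show ?thesis
        by (simp add: power_mult_distrib[of "sqrt (pmf P x) + sqrt (pmf Q x)"] distrib_right[of _ _ "t\<^sup>2 ^ x"] mult.assoc
              del: distrib_right_numeral)
    qed
    then have "(\<Sum>x<n. ((sqrt (pmf P x) + sqrt (pmf Q x)) * t ^ x)\<^sup>2)
        \<le> 2 * (\<Sum>x<n. pmf P x * t\<^sup>2 ^ x) + 2 * (\<Sum>x<n. pmf Q x * t\<^sup>2 ^ x)"
      by (simp add: sum_mono sum_distrib_left flip: sum.distrib)
    moreover have "(\<Sum>x<n. pmf P x * t\<^sup>2 ^ x) \<le> BP" "(\<Sum>x<n. pmf Q x * t\<^sup>2 ^ x) \<le> BQ"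
      using assms(1,2) sum_le_suminf[of "\<lambda>x. pmf P x * t\<^sup>2 ^ x" "{..<n}"]
        sum_le_suminf[of "\<lambda>x. pmf Q x * t\<^sup>2 ^ x" "{..<n}"]
      by (auto simp: sums_iff t_def)
    ultimately show ?thesis
      using assms(3,4) by linarith
  qed
  have "(norm (\<Sum>x<n. of_real (pmf P x - pmf Q x) * z ^ x))\<^sup>2 \<le> h * (4 * B)" for n
  proof -
    have "norm (\<Sum>x<n. of_real (pmf P x - pmf Q x) * z ^ x)
        \<le> (\<Sum>x<n. \<bar>sqrt (pmf P x) - sqrt (pmf Q x)\<bar> * ((sqrt (pmf P x) + sqrt (pmf Q x)) * t ^ x))"
    proof (rule sum_norm_le)
      fix x
      have "pmf P x - pmf Q x
          = (sqrt (pmf P x) - sqrt (pmf Q x)) * (sqrt (pmf P x) + sqrt (pmf Q x))"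
        by (simp add: algebra_simps)
      then have "\<bar>pmf P x - pmf Q x\<bar>
          = \<bar>sqrt (pmf P x) - sqrt (pmf Q x)\<bar> * (sqrt (pmf P x) + sqrt (pmf Q x))"
        by (simp add: abs_mult)
      then show "norm (of_real (pmf P x - pmf Q x) * z ^ x)
          \<le> \<bar>sqrt (pmf P x) - sqrt (pmf Q x)\<bar> * ((sqrt (pmf P x) + sqrt (pmf Q x)) * t ^ x)"
        by (simp add: norm_mult norm_power t_def mult.assoc del: of_real_diff)
    qed
    then have "(norm (\<Sum>x<n. of_real (pmf P x - pmf Q x) * z ^ x))\<^sup>2
        \<le> (\<Sum>x<n. \<bar>sqrt (pmf P x) - sqrt (pmf Q x)\<bar> * ((sqrt (pmf P x) + sqrt (pmf Q x)) * t ^ x))\<^sup>2"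
      by (intro power_mono) auto
    also have "\<dots> \<le> (\<Sum>x<n. \<bar>sqrt (pmf P x) - sqrt (pmf Q x)\<bar>\<^sup>2)
        * (\<Sum>x<n. ((sqrt (pmf P x) + sqrt (pmf Q x)) * t ^ x)\<^sup>2)"
      by (rule Cauchy_Schwarz_ineq_sum)
    also have "\<dots> \<le> h * (4 * B)"
      using h[of n] B[of n] h[of 0] by (intro mult_mono) (auto intro!: sum_nonneg)
    finally show ?thesis .
  qed
  moreover have "(\<lambda>n. (norm (\<Sum>x<n. of_real (pmf P x - pmf Q x) * z ^ x))\<^sup>2) \<longlonglongrightarrow> (norm D)\<^sup>2"
    using D unfolding sums_def by (intro tendsto_intros)
  ultimately have "(norm D)\<^sup>2 \<le> h * (4 * B)"
    by (intro LIMSEQ_le_const2) auto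
  then show ?thesis
    by (simp add: h_def mult.commute)
qed

text \<open>Generalised binomial series with exponent \<open>- r\<close> at \<open>- p z\<close>.
  The value is the \<open>r\<close>-th power of one quantity \<open>w\<close> independent of
  \<open>r\<close>, which makes generating functions of mixtures polynomials in
  \<open>w\<close>.\<close>

lemma NB_pgf_sums:
  fixes z :: complex
  assumes "0 < p" "p < 1" "p * norm z < 1"
  shows "(\<lambda>x. of_real (pmf (NB r p) x) * z ^ x) sums (of_real (1 - p) / (1 - of_real p * z)) ^ r"
proof -
  let ?u = "- (of_real p * z)"
  have gchoose: "complex_of_real ((- real r) gchoose x) = (- of_nat r) gchoose x" for x
    by (simp add: gbinomial_prod_rev)
  have u: "norm ?u < 1"
    using assms by (simp add: norm_mult)
  then have "1 + ?u \<noteq> 0"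
    by (metis add_eq_0_iff norm_minus_cancel norm_one less_irrefl)
  then have "(1 + ?u) powr (- of_nat r) = (1 / (1 + ?u)) ^ r"
    by (simp add: powr_minus powr_nat' power_one_over inverse_eq_divide)
  with gen_binomial_complex[OF u, of "- of_nat r"]
  have "(\<lambda>x. ((- of_nat r) gchoose x) * ?u ^ x) sums (1 / (1 + ?u)) ^ r"
    by simp
  from sums_mult[OF this, of "of_real (1 - p) ^ r"]
  have "(\<lambda>x. of_real (1 - p) ^ r * (((- of_nat r) gchoose x) * ?u ^ x))
      sums (of_real (1 - p) / (1 - of_real p * z)) ^ r"
    by (simp add: power_divide)
  moreover have "of_real (1 - p) ^ r * (((- of_nat r) gchoose x) * ?u ^ x)
      = of_real (pmf (NB r p) x) * z ^ x" for x
  proof -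
    have "?u ^ x = (-1) ^ x * of_real p ^ x * z ^ x"
      by (metis mult_minus1 power_mult_distrib mult.assoc)
    then show ?thesis
      using assms by (simp add: NB_def pmf_neg_binomial' flip: gchoose)
  qed
  ultimately show ?thesis
    by simp
qed

lemma NB_pgf_sums_real:
  assumes "0 < p" "p < 1" "0 \<le> t" "p * t < 1"
  shows "(\<lambda>x. pmf (NB r p) x * t ^ x) sums ((1 - p) / (1 - p * t)) ^ r"
proof -
  have "(\<lambda>x. complex_of_real (pmf (NB r p) x * t ^ x)) sums of_real (((1 - p) / (1 - p * t)) ^ r)"
    using NB_pgf_sums[of p "of_real t" r] assms by simp
  then show ?thesis
    by (simp only: sums_of_real_iff)
qed

section \<open>Polynomials near a boundary point of the disc\<close>

text \<open>
  On the unit circle, \<open>1 - norm (tangent_map u)\<close> vanishes only at \<open>u = 1\<close>, and to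
  second order. So a loss of \<open>1 / (1 - norm w)\<close> at \<open>w = tangent_map u\<close> is absorbed by the
  factor \<open>(1 - u)\<^sup>2 / 8\<close>, and near \<open>u = 1\<close> the curve behaves like an arc of the unit circle.
\<close>

definition tangent_map :: "complex \<Rightarrow> complex" where
  "tangent_map u = u * (1 + u) / 2"

lemma tangent_map_0 [simp]: "tangent_map 0 = 0"
  by (simp add: tangent_map_def)

lemma norm_tangent_map: "norm u = 1 \<Longrightarrow> (norm (tangent_map u))\<^sup>2 = (1 + Re u) / 2"
proof -
  assume "norm u = 1"
  then have "(Re u)\<^sup>2 + (Im u)\<^sup>2 = 1"
    by (simp add: cmod_def)
  then have "(norm (1 + u))\<^sup>2 = 2 + 2 * Re u"
    unfolding cmod_power2 by (simp add: power2_eq_square algebra_simps)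
  with \<open>norm u = 1\<close> show ?thesis
    by (simp add: tangent_map_def norm_mult norm_divide power_divide power_mult_distrib)
qed

lemma norm_tangent_map_le_1: "norm u = 1 \<Longrightarrow> norm (tangent_map u) \<le> 1"
proof -
  assume u: "norm u = 1"
  then have "(norm (tangent_map u))\<^sup>2 \<le> 1\<^sup>2"
    using norm_tangent_map[OF u] complex_Re_le_cmod[of u] by simp
  then show ?thesis
    by (rule power2_le_imp_le) simp
qed

text \<open>With \<open>\<rho> = norm (tangent_map u)\<close> the left side is
  \<open>(1 - \<rho>\<^sup>2) / 2\<close>, so the claim amounts to
  \<open>0 \<le> (1 - \<rho>)\<^sup>2\<close>.\<close>

lemma norm_diff_1_le: "norm u = 1 \<Longrightarrow> (norm (1 - u))\<^sup>2 / 8 \<le> 1 - norm (tangent_map u)"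
proof -
  assume u: "norm u = 1"
  then have "(Re u)\<^sup>2 + (Im u)\<^sup>2 = 1"
    by (simp add: cmod_def)
  then have "(norm (1 - u))\<^sup>2 = 2 - 2 * Re u"
    unfolding cmod_power2 by (simp add: power2_eq_square algebra_simps)
  moreover have "0 \<le> (norm (tangent_map u) - 1)\<^sup>2"
    by simp
  ultimately show ?thesis
    using norm_tangent_map[OF u] by (simp add: power2_diff field_simps)
qed

lemma ex_rotation_in_sector:
  assumes "norm u = 1" "0 < n"
  obtains j t where "j < n" "\<bar>t\<bar> \<le> pi / real n" "u * cis (2 * pi * real j / real n) = cis t"
proof -
  obtain s where s: "u = cis s"
    using assms(1) by (metis cis_Arg norm_zero one_neq_zero sgn_div_norm scaleR_one inverse_1)
  \<comment> \<open>\<open>k\<close> counts the turns by \<open>2 * pi / n\<close> that bring the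
    angle \<open>s\<close> closest to 0; the rounding error of at most 1/2 becomes the angle
    \<open>pi / n\<close>. Reducing \<open>k\<close> modulo \<open>n\<close> to \<open>j\<close>
    changes the angle by a multiple of \<open>2 * pi\<close> only.\<close>
  define k where "k = round (- s * real n / (2 * pi))"
  define t where "t = s + 2 * pi * real_of_int k / real n"
  define j where "j = nat (k mod int n)"
  have "\<bar>real_of_int k + s * real n / (2 * pi)\<bar> \<le> 1 / 2"
    using of_int_round_abs_le[of "- s * real n / (2 * pi)"] by (simp add: k_def)
  then have "(2 * pi / real n) * \<bar>real_of_int k + s * real n / (2 * pi)\<bar> \<le> (2 * pi / real n) * (1 / 2)"
    by (intro mult_left_mono) auto
  moreover have "t = (2 * pi / real n) * (real_of_int k + s * real n / (2 * pi))"
    using assms(2) by (simp add: t_def field_simps)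
  then have "\<bar>t\<bar> = (2 * pi / real n) * \<bar>real_of_int k + s * real n / (2 * pi)\<bar>"
    by (simp only: abs_mult) simp
  ultimately have "\<bar>t\<bar> \<le> pi / real n"
    by simp
  moreover have "int j = k - int n * (k div int n)"
    using assms(2) by (simp add: j_def minus_mult_div_eq_mod)
  then have "real j = real_of_int k - real n * real_of_int (k div int n)"
    by (metis of_int_diff of_int_mult of_int_of_nat_eq)
  then have kn: "real_of_int k / real n = real j / real n + real_of_int (k div int n)"
    using assms(2) by (simp add: field_simps)
  have "s + 2 * pi * real j / real n = t + 2 * pi * of_int (- (k div int n))"
    unfolding t_def times_divide_eq_right[symmetric] kn by (simp add: algebra_simps)
  then have "u * cis (2 * pi * real j / real n) = cis t * cis (2 * pi * of_int (- (k div int n)))"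
    by (simp only: s cis_mult)
  then have "u * cis (2 * pi * real j / real n) = cis t"
    by (subst (asm) cis_multiple_2pi) simp_all
  moreover have "j < n"
    using assms(2) by (simp add: j_def nat_less_iff)
  ultimately show ?thesis
    using that by simp
qed

lemma norm_le_of_norm_le_on_circle:
  fixes f :: "complex \<Rightarrow> complex"
  assumes hol: "f holomorphic_on UNIV" and "0 < r" and "\<And>u. norm u = r \<Longrightarrow> norm (f u) \<le> B"
    and z: "norm z \<le> r"
  shows "norm (f z) \<le> B"
proof (rule maximum_modulus_frontier[of f "cball 0 r"])
  show "f holomorphic_on interior (cball 0 r)"
    using hol by (rule holomorphic_on_subset) simp
  show "continuous_on (closure (cball 0 r)) f"
    using hol holomorphic_on_imp_continuous_on continuous_on_subset by blast
qed (use assms in auto)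

text \<open>The maximum principle is applied to a product of \<open>n\<close> rotated copies of the
  function \<open>h\<close> below. Its value at 0 has modulus 1/8, hence the bound
  \<open>(1 / 8) ^ n\<close>.\<close>

lemma ex_large_on_tangent_arc:
  fixes f :: "complex \<Rightarrow> complex"
  assumes hol: "f holomorphic_on UNIV" and f0: "norm (f 0) = 1" and "0 < n"
    and bound: "\<And>w. norm w < 1 \<Longrightarrow> norm (f w) * (1 - norm w) \<le> 1"
  obtains t where "\<bar>t\<bar> \<le> pi / real n" "(1 / 8) ^ n \<le> norm (f (tangent_map (cis t)))"
proof (rule ccontr)
  assume "\<not> thesis"
  with that have small: "norm (f (tangent_map (cis t))) < (1 / 8) ^ n" if "\<bar>t\<bar> \<le> pi / real n" for t
    using that not_le by blast
  define h where "h u = f (tangent_map u) * (1 - u)\<^sup>2 / 8" for u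
  \<comment> \<open>Every point of the circle has one of its \<open>n\<close> rotations in the sector where \<open>f\<close> is small,
    and the other factors are at most 1, so \<open>F\<close> is too small on the circle for its value at 0.\<close>
  define F where "F u = (\<Prod>j<n. h (u * cis (2 * pi * real j / real n)))" for u
  have h_hol: "h holomorphic_on UNIV"
  proof -
    have "(f \<circ> tangent_map) holomorphic_on UNIV"
      using hol by (intro holomorphic_on_compose_gen[of _ _ _ UNIV]) (auto simp: tangent_map_def[abs_def] intro!: holomorphic_intros)
    then show ?thesis
      unfolding h_def o_def by (intro holomorphic_intros) auto
  qed
  have "F holomorphic_on UNIV"
  proof -
    have "(\<lambda>u. h (u * c)) holomorphic_on UNIV" for c
      using holomorphic_on_compose_gen[OF holomorphic_on_mult[OF holomorphic_on_ident holomorphic_on_const] h_hol]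
      by (simp add: o_def)
    then show ?thesis
      unfolding F_def by (intro holomorphic_on_prod) auto
  qed
  have h_le: "norm (h u) \<le> 1" if u: "norm u = 1" for u
  proof (cases "u = 1")
    case False
    then have "norm (1 - u) > 0"
      by simp
    then have "norm (tangent_map u) < 1"
      using norm_diff_1_le[OF u] by (smt (verit) divide_pos_pos zero_less_power)
    have "norm (h u) = norm (f (tangent_map u)) * ((norm (1 - u))\<^sup>2 / 8)"
      by (simp add: h_def norm_mult norm_divide norm_power)
    also have "\<dots> \<le> norm (f (tangent_map u)) * (1 - norm (tangent_map u))"
      using norm_diff_1_le[OF u] by (intro mult_left_mono) auto
    also have "\<dots> \<le> 1"
      by (rule bound) fact
    finally show ?thesis .
  qed (simp add: h_def)
  have "norm (F u) \<le> (1 / 8) ^ n / 2" if u: "norm u = 1" for u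
  proof -
    obtain j t where j: "j < n" "\<bar>t\<bar> \<le> pi / real n" "u * cis (2 * pi * real j / real n) = cis t"
      using ex_rotation_in_sector[OF u \<open>0 < n\<close>] by blast
    let ?h = "\<lambda>j. norm (h (u * cis (2 * pi * real j / real n)))"
    have "norm (F u) = ?h j * (\<Prod>i\<in>{..<n} - {j}. ?h i)"
      using j(1) by (simp add: F_def prod.remove norm_mult flip: prod_norm)
    also have "\<dots> \<le> ?h j * 1"
      using u by (intro mult_left_mono prod_le_1) (auto simp: norm_mult intro!: h_le)
    also have "?h j = norm (f (tangent_map (cis t))) * ((norm (1 - cis t))\<^sup>2 / 8)"
      by (simp add: j(3) h_def norm_mult norm_divide norm_power)
    \<comment> \<open>The bound 4 / 8 = 1 / 2 on this factor is the gain that contradicts the exact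
      value of \<open>norm (F 0)\<close>.\<close>
    also have "(norm (1 - cis t))\<^sup>2 \<le> 2\<^sup>2"
      using norm_triangle_ineq4[of 1 "cis t"] by (intro power_mono) auto
    then have "norm (f (tangent_map (cis t))) * ((norm (1 - cis t))\<^sup>2 / 8) \<le> (1 / 8) ^ n * (1 / 2)"
      using small[OF j(2)] by (intro mult_mono) auto
    finally show ?thesis by simp
  qed
  then have "norm (F 0) \<le> (1 / 8) ^ n / 2"
    by (rule norm_le_of_norm_le_on_circle[OF \<open>F holomorphic_on UNIV\<close> zero_less_one]) simp_all
  moreover have "norm (F 0) = (1 / 8) ^ n"
    using f0 by (simp add: F_def h_def norm_divide norm_power)
  ultimately show False
    by simp
qed

lemma sum_power_mult_le_1:
  fixes s :: real
  assumes "0 \<le> s" "s < 1"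
  shows "(\<Sum>i<n. s ^ i) * (1 - s) \<le> 1"
  using assms by (simp add: one_diff_power_eq[symmetric] mult.commute)

text \<open>Dividing by \<open>w ^ a\<close> leaves a polynomial \<open>f\<close> with
  \<open>norm (f 0) = 1\<close>, and the geometric series gives the growth bound on
  \<open>f\<close>. Restoring \<open>w ^ a\<close> costs at most \<open>norm w ^ N\<close>, as
  \<open>norm w\<close> is at most 1 on the curve.\<close>

lemma ex_large_polynomial_on_tangent_arc:
  fixes c :: "nat \<Rightarrow> complex"
  assumes c: "\<And>j. norm (c j) \<le> 1" and zero: "\<And>j. j < a \<Longrightarrow> c j = 0" and a: "norm (c a) = 1"
    and "a \<le> N" "0 < n"
  obtains t where "\<bar>t\<bar> \<le> pi / real n"
    "(1 / 8) ^ n * norm (tangent_map (cis t)) ^ N \<le> norm (\<Sum>j\<le>N. c j * tangent_map (cis t) ^ j)"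
proof -
  define f where "f w = (\<Sum>i<Suc (N - a). c (a + i) * w ^ i)" for w
  have split: "(\<Sum>j\<le>N. c j * w ^ j) = w ^ a * f w" for w
  proof -
    have "(\<Sum>j\<le>N. c j * w ^ j) = (\<Sum>j\<in>{a..N}. c j * w ^ j)"
      using zero by (intro sum.mono_neutral_right) (auto simp: not_le)
    also have "\<dots> = (\<Sum>i<Suc (N - a). c (a + i) * w ^ (a + i))"
      using \<open>a \<le> N\<close> by (intro sum.reindex_bij_witness[of _ "\<lambda>i. a + i" "\<lambda>j. j - a"]) auto
    finally show ?thesis
      by (simp add: f_def sum_distrib_left power_add mult_ac del: sum.lessThan_Suc)
  qed
  obtain t where t: "\<bar>t\<bar> \<le> pi / real n" "(1 / 8) ^ n \<le> norm (f (tangent_map (cis t)))"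
  proof (rule ex_large_on_tangent_arc[of f n])
    show "f holomorphic_on UNIV"
      unfolding f_def by (intro holomorphic_intros)
    show "norm (f 0) = 1"
      using a by (simp add: f_def power_0_left if_distrib sum.lessThan_Suc_shift del: sum.lessThan_Suc cong: if_cong)
    show "norm (f w) * (1 - norm w) \<le> 1" if "norm w < 1" for w
    proof -
      have "norm (f w) \<le> (\<Sum>i<Suc (N - a). norm w ^ i)"
        unfolding f_def using c by (intro sum_norm_le) (auto simp: norm_mult norm_power intro!: mult_left_le_one_le)
      then have "norm (f w) * (1 - norm w) \<le> (\<Sum>i<Suc (N - a). norm w ^ i) * (1 - norm w)"
        using that by (intro mult_right_mono) auto
      also have "\<dots> \<le> 1"
        using that by (intro sum_power_mult_le_1) auto
      finally show ?thesis .
    qed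
  qed (use \<open>0 < n\<close> in auto)
  have "(1 / 8) ^ n * norm (tangent_map (cis t)) ^ N \<le> norm (f (tangent_map (cis t))) * norm (tangent_map (cis t)) ^ a"
    using t(2) \<open>a \<le> N\<close> norm_tangent_map_le_1[of "cis t"] by (intro mult_mono power_decreasing) auto
  then show ?thesis
    using that[OF t(1)] by (simp add: split norm_mult norm_power mult.commute)
qed

text \<open>Maximum principle for the reversed polynomial \<open>S\<close>, which satisfies
  \<open>S (1 / w) = poly P w / w ^ N\<close>: the exterior of the disc of radius \<open>R\<close>
  becomes the disc of radius \<open>1 / R\<close>.\<close>

lemma poly_norm_extrapolation:
  fixes P :: "complex poly"
  assumes deg: "degree P \<le> N" and R: "0 < R" "R \<le> norm z"
    and bound: "\<And>w. norm w = R \<Longrightarrow> norm (poly P w) \<le> M"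
  shows "norm (poly P z) \<le> M * (norm z / R) ^ N"
proof -
  define S where "S u = (\<Sum>i\<le>N. coeff P i * u ^ (N - i))" for u
  have S: "S (inverse w) = poly P w / w ^ N" if "w \<noteq> 0" for w
  proof -
    have "poly P w = (\<Sum>i\<le>N. coeff P i * w ^ i)"
      unfolding poly_altdef using deg by (intro sum.mono_neutral_left) (auto simp: coeff_eq_0)
    moreover have "inverse w ^ (N - i) = w ^ i / w ^ N" if "i \<le> N" for i
      using that \<open>w \<noteq> 0\<close> by (simp add: power_diff field_simps power_inverse)
    ultimately show ?thesis
      by (simp add: S_def sum_divide_distrib)
  qed
  have "norm (S u) \<le> M / R ^ N" if "norm u = 1 / R" for u
  proof -
    have "u \<noteq> 0" using that R by auto
    then have "S u = poly P (inverse u) / inverse u ^ N"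
      using S[of "inverse u"] by simp
    moreover have "norm (inverse u) = R"
      using that by (simp add: norm_inverse)
    ultimately show ?thesis
      using bound[of "inverse u"] R by (simp add: norm_divide norm_power divide_right_mono)
  qed
  moreover have "S holomorphic_on UNIV"
    unfolding S_def by (intro holomorphic_intros)
  moreover have "norm (inverse z) \<le> 1 / R" "0 < 1 / R"
    using R by (simp_all add: norm_inverse le_imp_inverse_le inverse_eq_divide[symmetric])
  ultimately have "norm (S (inverse z)) \<le> M / R ^ N"
    using norm_le_of_norm_le_on_circle[of S "1 / R"] by blast
  moreover have "z \<noteq> 0" using R by auto
  ultimately show ?thesis
    using S[of z] R by (simp add: norm_divide norm_power power_divide pos_divide_le_eq)
qed

section \<open>Separation of mixtures\<close>

lemma one_minus_ge_exp: "exp (- 2 * x) \<le> 1 - x" if "0 \<le> x" "x \<le> 1 / 2" for x :: real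
proof -
  have "1 \<le> (1 + 2 * x) * (1 - x)"
    using mult_nonneg_nonneg[of x "1 - 2 * x"] that by (simp add: algebra_simps)
  also have "\<dots> \<le> exp (2 * x) * (1 - x)"
    using that by (intro mult_right_mono exp_ge_add_one_self) auto
  finally show ?thesis
    by (simp add: exp_minus field_simps)
qed

text \<open>For \<open>u = cis t\<close> the left side is
  \<open>1 - (norm (tangent_map u))\<^sup>2\<close>. It equals \<open>(sin (t / 2))\<^sup>2\<close>,
  and the constant 4 comes from \<open>pi < 4\<close>.\<close>

lemma one_minus_cos_le:
  assumes "\<bar>t\<bar> \<le> pi / real n"
  shows "(1 - cos t) / 2 \<le> 4 / (real n)\<^sup>2"
proof -
  have "(1 - cos t) / 2 = (sin (t / 2))\<^sup>2"
    using cos_double_sin[of "t / 2"] by simp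
  also have "\<dots> \<le> (pi / real n / 2)\<^sup>2"
    using assms abs_sin_x_le_abs_x[of "t / 2"] by (intro abs_le_square_iff[THEN iffD1]) auto
  also have "\<dots> \<le> (4 / real n / 2)\<^sup>2"
    using pi_less_4 by (intro power_mono divide_right_mono) auto
  finally show ?thesis
    by (simp add: power_divide)
qed

text \<open>\<open>z\<close> solves \<open>w = (1 - p) / (1 - p z)\<close> for
  \<open>w = tangent_map u\<close>. Its modulus follows from \<open>p z w = w - (1 - p)\<close>,
  where \<open>(norm w)\<^sup>2 = 1 - y\<close> and
  \<open>Re w = (1 - y) * (1 - 4 * y)\<close>.\<close>

lemma norm_tangent_map_preimage_le:
  assumes u: "norm u = 1" and y: "y = (1 - Re u) / 2" "y \<le> 1 / 2" and p: "0 < p" "p < 1"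
    and z: "z = (1 - of_real (1 - p) / tangent_map u) / of_real p"
  shows "p\<^sup>2 * (norm z)\<^sup>2 \<le> p\<^sup>2 + 10 * (1 - p) * y"
proof -
  define q where "q = 1 - p"
  have y0: "0 \<le> y"
    using y complex_Re_le_cmod[of u] u by simp
  have w2: "(norm (tangent_map u))\<^sup>2 = 1 - y"
    using norm_tangent_map[OF u] y by (simp add: field_simps)
  then have "tangent_map u \<noteq> 0"
    using y by auto
  have "(Re u)\<^sup>2 + (Im u)\<^sup>2 = 1"
    using u by (simp add: cmod_def)
  then have im: "(Im u)\<^sup>2 = 1 - (Re u)\<^sup>2"
    by simp
  have "Re u = 1 - 2 * y"
    using y by simp
  moreover have re_tangent_map: "Re (tangent_map u) = (Re u + (Re u)\<^sup>2 - (Im u)\<^sup>2) / 2"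
    by (simp add: tangent_map_def algebra_simps power2_eq_square)
  ultimately have re: "Re (tangent_map u) = (1 - y) * (1 - 4 * y)"
    by (simp add: re_tangent_map im) (simp add: algebra_simps power2_eq_square)
  have "(norm (tangent_map u - of_real q))\<^sup>2 = (norm (tangent_map u))\<^sup>2 - 2 * q * Re (tangent_map u) + q\<^sup>2"
    unfolding cmod_power2 by (simp add: power2_diff)
  moreover have "of_real p * z * tangent_map u = tangent_map u - of_real q"
    using \<open>tangent_map u \<noteq> 0\<close> p by (simp add: z q_def field_simps)
  then have "norm (tangent_map u - of_real q) = p * norm z * norm (tangent_map u)"
    using p by (metis norm_mult norm_of_real abs_of_pos)
  ultimately have "p\<^sup>2 * (norm z)\<^sup>2 * (1 - y) = (1 - y) - 2 * q * ((1 - y) * (1 - 4 * y)) + q\<^sup>2"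
    by (simp add: power_mult_distrib w2 re)
  \<comment> \<open>The constant 10 makes the remainder exactly
    \<open>q * y * (2 - q - 2 * y)\<close>, which is nonnegative since \<open>q < 1\<close> and
    \<open>y \<le> 1 / 2\<close>.\<close>
  also have "\<dots> = (p\<^sup>2 + 10 * q * y) * (1 - y) - q * y * (2 - q - 2 * y)"
    by (simp add: q_def algebra_simps power2_eq_square)
  also have "\<dots> \<le> (p\<^sup>2 + 10 * q * y) * (1 - y)"
    using y y0 p by (simp add: q_def)
  finally show ?thesis
    using y(2) by (simp add: q_def)
qed

section \<open>Mixtures indexed by parameter sets\<close>

text \<open>Indexing by the set instead of an enumeration makes the hypotheses of the estimator
  exactly the possible outputs.\<close>

definition NB_mixture :: "real \<Rightarrow> nat set \<Rightarrow> nat pmf" where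
  "NB_mixture p S = bind_pmf (pmf_of_set S) (\<lambda>r. NB r p)"

lemma uniform_mixture_NB:
  assumes "1 \<le> k" "inj_on r {1..k}"
  shows "uniform_mixture k (\<lambda>i. NB (r i) p) = NB_mixture p (r ` {1..k})"
  using assms
  by (simp add: uniform_mixture_def NB_mixture_def bind_map_pmf flip: map_pmf_of_set_inj)

lemma pmf_NB_mixture:
  assumes "finite S" "S \<noteq> {}"
  shows "pmf (NB_mixture p S) x = (\<Sum>r\<in>S. pmf (NB r p) x) / real (card S)"
  using assms by (simp add: NB_mixture_def pmf_bind_pmf_of_set)

lemma NB_mixture_pgf_sums:
  fixes z :: complex
  assumes "finite S" "S \<noteq> {}" "0 < p" "p < 1" "p * norm z < 1"
  shows "(\<lambda>x. of_real (pmf (NB_mixture p S) x) * z ^ x)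
    sums ((\<Sum>r\<in>S. (of_real (1 - p) / (1 - of_real p * z)) ^ r) / of_nat (card S))"
proof -
  have "(\<lambda>x. (\<Sum>r\<in>S. of_real (pmf (NB r p) x) * z ^ x) / of_nat (card S))
    sums ((\<Sum>r\<in>S. (of_real (1 - p) / (1 - of_real p * z)) ^ r) / of_nat (card S))"
    using assms by (intro sums_divide sums_sum NB_pgf_sums)
  then show ?thesis
    using assms by (simp add: pmf_NB_mixture sum_distrib_right)
qed

text \<open>Used at \<open>t = (norm z)\<^sup>2\<close> as the second moment bound. The condition
  \<open>1 \<le> b\<close> allows every exponent \<open>r\<close> in \<open>S\<close> to be raised
  to \<open>N\<close>.\<close>

lemma NB_mixture_pgf_sums_le:
  assumes S: "S \<noteq> {}" "S \<subseteq> {1..N}" and p: "0 < p" "p < 1" and t: "0 \<le> t" "p * t < 1"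
    and b: "(1 - p) / (1 - p * t) \<le> b" "1 \<le> b"
  obtains G where "(\<lambda>x. pmf (NB_mixture p S) x * t ^ x) sums G" "G \<le> b ^ N"
proof
  have fin: "finite S"
    using S finite_subset by blast
  let ?a = "(1 - p) / (1 - p * t)"
  have "(\<lambda>x. (\<Sum>r\<in>S. pmf (NB r p) x * t ^ x) / real (card S)) sums ((\<Sum>r\<in>S. ?a ^ r) / real (card S))"
    using assms by (intro sums_divide sums_sum NB_pgf_sums_real)
  then show "(\<lambda>x. pmf (NB_mixture p S) x * t ^ x) sums ((\<Sum>r\<in>S. ?a ^ r) / real (card S))"
    using fin S by (simp add: pmf_NB_mixture sum_distrib_right)
  have "(\<Sum>r\<in>S. ?a ^ r) \<le> (\<Sum>r\<in>S. b ^ N)"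
  proof (rule sum_mono)
    fix r assume "r \<in> S"
    have "?a ^ r \<le> b ^ r"
      using p t b by (intro power_mono) auto
    also have "\<dots> \<le> b ^ N"
      using S \<open>r \<in> S\<close> b by (intro power_increasing) auto
    finally show "?a ^ r \<le> b ^ N" .
  qed
  then show "(\<Sum>r\<in>S. ?a ^ r) / real (card S) \<le> b ^ N"
    using fin S by (simp add: field_simps card_gt_0_iff)
qed

text \<open>Coefficients in {-1, 0, 1} of the polynomial \<open>A\<close>, complex-valued to match
  the analytic lemmas.\<close>

definition ind_diff :: "nat set \<Rightarrow> nat set \<Rightarrow> nat \<Rightarrow> complex" where
  "ind_diff S S' j = of_bool (j \<in> S) - of_bool (j \<in> S')"

lemma sum_ind_diff:
  assumes "S \<subseteq> {1..N}" "S' \<subseteq> {1..N}"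
  shows "(\<Sum>j\<le>N. ind_diff S S' j * w ^ j) = (\<Sum>j\<in>S. w ^ j) - (\<Sum>j\<in>S'. w ^ j)"
proof -
  have "(\<Sum>j\<le>N. of_bool (j \<in> A) * w ^ j) = (\<Sum>j\<in>A. w ^ j)" if "A \<subseteq> {1..N}" for A
  proof -
    have "(\<Sum>j\<le>N. of_bool (j \<in> A) * w ^ j) = (\<Sum>j\<in>A. of_bool (j \<in> A) * w ^ j)"
      using that by (intro sum.mono_neutral_right) auto
    then show ?thesis by simp
  qed
  with assms show ?thesis
    by (simp add: ind_diff_def left_diff_distrib sum_subtractf)
qed

text \<open>Equal cardinalities give both mixtures the same normalisation, so the difference of the
  generating functions at \<open>z\<close> is this polynomial at \<open>w\<close> divided by
  \<open>card S\<close>. Both second moments at \<open>z\<close> are at most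
  \<open>b ^ N\<close>.\<close>

lemma norm_sum_ind_diff_le:
  assumes S: "S \<noteq> {}" "S \<subseteq> {1..N}" "S' \<noteq> {}" "S' \<subseteq> {1..N}" "card S' = card S"
    and p: "0 < p" "p < 1" and z: "p * (norm z)\<^sup>2 < 1"
    and b: "(1 - p) / (1 - p * (norm z)\<^sup>2) \<le> b" "1 \<le> b"
    and w: "w = of_real (1 - p) / (1 - of_real p * z)"
  shows "(norm (\<Sum>j\<le>N. ind_diff S S' j * w ^ j))\<^sup>2
    \<le> 4 * (real (card S))\<^sup>2 * b ^ N * (2 - 2 * bhattacharyya (NB_mixture p S) (NB_mixture p S'))"
proof -
  let ?P = "NB_mixture p S" and ?Q = "NB_mixture p S'"
  let ?A = "\<Sum>j\<le>N. ind_diff S S' j * w ^ j"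
  have fin: "finite S" "finite S'"
    using S finite_subset by blast+
  then have k: "card S > 0"
    using S by (simp add: card_gt_0_iff)
  have "p * (p * (norm z)\<^sup>2) \<le> 1 * (p * (norm z)\<^sup>2)"
    using p by (intro mult_right_mono) auto
  then have "(p * norm z)\<^sup>2 < 1\<^sup>2"
    using z by (simp add: power_mult_distrib power2_eq_square mult_ac)
  then have z1: "p * norm z < 1"
    using power2_less_imp_less by fastforce
  obtain G where G: "(\<lambda>x. pmf ?P x * (norm z)\<^sup>2 ^ x) sums G" "G \<le> b ^ N"
    by (rule NB_mixture_pgf_sums_le[OF S(1,2) p zero_le_power2 z b])
  obtain G' where G': "(\<lambda>x. pmf ?Q x * (norm z)\<^sup>2 ^ x) sums G'" "G' \<le> b ^ N"
    by (rule NB_mixture_pgf_sums_le[OF S(3,4) p zero_le_power2 z b])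
  have "(\<lambda>x. of_real (pmf ?P x) * z ^ x - of_real (pmf ?Q x) * z ^ x)
      sums ((\<Sum>r\<in>S. w ^ r) / of_nat (card S) - (\<Sum>r\<in>S'. w ^ r) / of_nat (card S'))"
    unfolding w using S fin p z1 by (intro sums_diff NB_mixture_pgf_sums)
  then have "(\<lambda>x. of_real (pmf ?P x - pmf ?Q x) * z ^ x) sums (?A / of_nat (card S))"
    using S by (simp add: sum_ind_diff diff_divide_distrib left_diff_distrib)
  from pgf_diff_le_hellinger[OF G(1) G'(1) G(2) G'(2) this] show ?thesis
    using k by (simp add: norm_divide power_divide field_simps)
qed

text \<open>The least element in which \<open>S\<close> and \<open>S'\<close> differ is the index of
  the lowest nonzero coefficient, which is 1 or -1.\<close>

lemma ex_large_ind_diff_on_tangent_arc: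
  assumes "S \<noteq> S'" "S \<subseteq> {1..N}" "S' \<subseteq> {1..N}" "0 < n"
  obtains u where "norm u = 1" "(1 - Re u) / 2 \<le> 4 / (real n)\<^sup>2"
    "(1 / 8) ^ n * norm (tangent_map u) ^ N \<le> norm (\<Sum>j\<le>N. ind_diff S S' j * tangent_map u ^ j)"
proof -
  define a where "a = (LEAST j. (j \<in> S) \<noteq> (j \<in> S'))"
  have "\<exists>j. (j \<in> S) \<noteq> (j \<in> S')"
    using assms(1) by blast
  then have a: "(a \<in> S) \<noteq> (a \<in> S')"
    unfolding a_def by (rule LeastI_ex)
  have less: "(j \<in> S) = (j \<in> S')" if "j < a" for j
    using not_less_Least that unfolding a_def by blast
  obtain t where "\<bar>t\<bar> \<le> pi / real n"
    "(1 / 8) ^ n * norm (tangent_map (cis t)) ^ N \<le> norm (\<Sum>j\<le>N. ind_diff S S' j * tangent_map (cis t) ^ j)"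
  proof (rule ex_large_polynomial_on_tangent_arc[of "ind_diff S S'" a N n])
    show "a \<le> N"
      using a assms by auto
  qed (use a less assms in \<open>auto simp: ind_diff_def\<close>)
  then show ?thesis
    using that[of "cis t"] one_minus_cos_le by simp
qed

lemma powr_third_cubed: "(x powr (1 / 3)) ^ 3 = x" if "0 < x" for x :: real
proof -
  have "(x powr (1 / 3)) ^ 3 = (x powr (1 / 3)) powr real 3"
    using that by (subst powr_realpow) auto
  then show ?thesis
    using that by (simp add: powr_powr)
qed

section \<open>Lower bounds for the Hellinger distance of two candidate mixtures\<close>

locale distinct_mixtures =
  fixes N :: nat and p :: real and S S' :: "nat set"
  assumes p: "0 < p" "p < 1"
    and S: "S \<noteq> {}" "S \<subseteq> {1..N}" and S': "S' \<noteq> {}" "S' \<subseteq> {1..N}"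
    and card_eq: "card S' = card S" and neq: "S \<noteq> S'"
begin

definition L :: real where "L = (real N / p) powr (1 / 3)"

definition h2 :: real where "h2 = 2 - 2 * bhattacharyya (NB_mixture p S) (NB_mixture p S')"

lemma N_ge_1: "1 \<le> N"
  using S by auto

lemma L_cubed: "L ^ 3 = real N / p"
  using N_ge_1 p by (simp add: L_def powr_third_cubed)

lemma L_ge_1: "1 \<le> L"
proof -
  have "p \<le> real N"
    using N_ge_1 p by linarith
  then have "1 \<le> real N / p"
    using p by simp
  then show ?thesis
    unfolding L_def by (intro ge_one_powr_ge_zero) auto
qed

text \<open>Squared form of the arc bound, expressed through the deficit
  \<open>y = 1 - (norm w)\<^sup>2\<close> that controls all later estimates.\<close>

lemma ex_large_ind_diff:
  assumes "0 < n"
  obtains u y where "norm u = 1" "y = (1 - Re u) / 2" "0 \<le> y" "y \<le> 4 / (real n)\<^sup>2"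
    "(norm (tangent_map u))\<^sup>2 = 1 - y"
    "(1 / 64) ^ n * (1 - y) ^ N \<le> (norm (\<Sum>j\<le>N. ind_diff S S' j * tangent_map u ^ j))\<^sup>2"
proof -
  obtain u where u: "norm u = 1" "(1 - Re u) / 2 \<le> 4 / (real n)\<^sup>2"
    and A: "(1 / 8) ^ n * norm (tangent_map u) ^ N \<le> norm (\<Sum>j\<le>N. ind_diff S S' j * tangent_map u ^ j)"
    using ex_large_ind_diff_on_tangent_arc[OF neq S(2) S'(2) assms] by blast
  define y where "y = (1 - Re u) / 2"
  have w: "(norm (tangent_map u))\<^sup>2 = 1 - y"
    using norm_tangent_map[OF u(1)] by (simp add: y_def field_simps)
  have "((1 / 8) ^ n * norm (tangent_map u) ^ N)\<^sup>2 = ((1 / 8)\<^sup>2) ^ n * ((norm (tangent_map u))\<^sup>2) ^ N"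
    unfolding power_mult_distrib power_mult[symmetric] by (simp add: mult.commute)
  also have "\<dots> = (1 / 64) ^ n * (1 - y) ^ N"
    by (simp add: w power_divide)
  finally have "(1 / 64) ^ n * (1 - y) ^ N \<le> (norm (\<Sum>j\<le>N. ind_diff S S' j * tangent_map u ^ j))\<^sup>2"
    using power_mono[OF A, of 2] by simp
  moreover have "0 \<le> y"
    using u complex_Re_le_cmod[of u] by (simp add: y_def)
  ultimately show ?thesis
    using that[OF u(1) y_def _ u(2)[folded y_def] w] by blast
qed

text \<open>Here \<open>L \<le> N\<close>, equivalently \<open>1 \<le> L\<^sup>2 * p\<close>, which
  keeps the second moment finite on an arc of length of order \<open>1 / L\<close>. The exponent 52
  is 50 for \<open>(1 / 64) ^ n\<close>, 1 for \<open>(1 - y) ^ N\<close> and 1 for the second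
  moment.\<close>

lemma hellinger_large_N:
  assumes large: "1 \<le> (real N)\<^sup>2 * p"
  shows "exp (- 52 * L) \<le> 4 * (real (card S))\<^sup>2 * h2"
proof -
  \<comment> \<open>The factor 9 gives \<open>y / p \<le> 4 / 81\<close>, so that
    \<open>10 * (y / p) \<le> 1 / 2\<close> as \<open>one_minus_ge_exp\<close> requires, and
    \<open>20 * (y / p) * N \<le> L\<close>.\<close>
  define n where "n = nat \<lceil>9 * L\<rceil>"
  have n: "9 * L \<le> real n" "real n \<le> 10 * L"
    using L_ge_1 unfolding n_def by linarith+
  then have "0 < n"
    using L_ge_1 by (cases n) auto
  obtain u y where u: "norm u = 1" and y: "y = (1 - Re u) / 2" "0 \<le> y" "y \<le> 4 / (real n)\<^sup>2"
    and w2: "(norm (tangent_map u))\<^sup>2 = 1 - y"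
    and A: "(1 / 64) ^ n * (1 - y) ^ N \<le> (norm (\<Sum>j\<le>N. ind_diff S S' j * tangent_map u ^ j))\<^sup>2"
    by (rule ex_large_ind_diff[OF \<open>0 < n\<close>])
  have "(9 * L)\<^sup>2 \<le> (real n)\<^sup>2"
    using n L_ge_1 by (intro power_mono) auto
  then have "4 / (real n)\<^sup>2 \<le> 4 / (81 * L\<^sup>2)"
    using L_ge_1 \<open>0 < n\<close> by (intro divide_left_mono) (auto simp: power_mult_distrib)
  then have yL: "y \<le> 4 / (81 * L\<^sup>2)"
    using y by simp
  have "L ^ 3 \<le> real N ^ 3"
  proof -
    have "real N \<le> real N * ((real N)\<^sup>2 * p)"
      using mult_left_mono[OF large, of "real N"] by simp
    then show ?thesis
      unfolding L_cubed using p by (simp add: field_simps power2_eq_square power3_eq_cube)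
  qed
  then have "L \<le> real N"
    using power_mono_iff[of L "real N" 3] L_ge_1 by simp
  have L2p: "1 \<le> L\<^sup>2 * p"
  proof -
    have "L * (L\<^sup>2 * p) = real N"
      using L_cubed p by (simp add: power2_eq_square power3_eq_cube field_simps)
    with \<open>L \<le> real N\<close> L_ge_1 have "L * 1 \<le> L * (L\<^sup>2 * p)"
      by simp
    then show ?thesis
      using L_ge_1 by (subst (asm) mult_le_cancel_left_pos) auto
  qed
  \<comment> \<open>\<open>s\<close> is the scale of the second moment: its base
    \<open>(1 - p) / (1 - p * (norm z)\<^sup>2)\<close> turns out to be at most
    \<open>exp (20 * s)\<close>.\<close>
  define s where "s = y / p"
  have ys: "y \<le> s"
    using y(2) p mult_left_le[of p y] by (simp add: s_def pos_le_divide_eq)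
  have s: "0 \<le> s" "s \<le> 4 / 81" "s * real N \<le> 4 / 81 * L"
  proof -
    show "0 \<le> s"
      using y p by (simp add: s_def)
    have "s \<le> 4 / (81 * L\<^sup>2) / p"
      unfolding s_def using yL p by (intro divide_right_mono) auto
    then have *: "s \<le> 4 / 81 / (L\<^sup>2 * p)"
      by (simp add: mult.assoc)
    also have "\<dots> \<le> 4 / 81 / 1"
      using L2p by (intro divide_left_mono) auto
    finally show "s \<le> 4 / 81"
      by simp
    have "s * real N \<le> 4 / 81 / (L\<^sup>2 * p) * real N"
      using * by (intro mult_right_mono) auto
    also have "\<dots> = 4 / 81 / (L\<^sup>2 * p) * (L ^ 3 * p)"
      using L_cubed p by simp
    also have "\<dots> = 4 / 81 * L"
      using L_ge_1 p by (simp add: power2_eq_square power3_eq_cube)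
    finally show "s * real N \<le> 4 / 81 * L" .
  qed
  define z where "z = (1 - of_real (1 - p) / tangent_map u) / of_real p"
  have "tangent_map u \<noteq> 0"
    using w2 s ys by auto
  have "p\<^sup>2 * (norm z)\<^sup>2 \<le> p\<^sup>2 + 10 * (1 - p) * y"
    using ys s by (intro norm_tangent_map_preimage_le[OF u y(1) _ p z_def]) auto
  then have "p * (p * (norm z)\<^sup>2) \<le> p * (p + 10 * (1 - p) * s)"
    using p by (simp add: s_def power2_eq_square algebra_simps)
  then have "p * (norm z)\<^sup>2 \<le> p + 10 * (1 - p) * s"
    using p by (subst (asm) mult_le_cancel_left_pos) auto
  then have pz: "(1 - p) * (1 - 10 * s) \<le> 1 - p * (norm z)\<^sup>2"
    by (simp add: algebra_simps)
  have "exp (- 2 * (10 * s)) \<le> 1 - 10 * s"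
    using s by (intro one_minus_ge_exp) auto
  then have "(1 - p) * exp (- (20 * s)) \<le> (1 - p) * (1 - 10 * s)"
    using p by (intro mult_left_mono) auto
  with pz have pz: "(1 - p) * exp (- (20 * s)) \<le> 1 - p * (norm z)\<^sup>2"
    by linarith
  moreover have "0 < (1 - p) * exp (- (20 * s))"
    using p by simp
  ultimately have "0 < 1 - p * (norm z)\<^sup>2"
    by linarith
  moreover from this pz have "(1 - p) / (1 - p * (norm z)\<^sup>2) \<le> exp (20 * s)"
    by (simp add: exp_minus field_simps)
  moreover have "tangent_map u = of_real (1 - p) / (1 - of_real p * z)"
    using \<open>tangent_map u \<noteq> 0\<close> p by (simp add: z_def field_simps)
  ultimately have "(norm (\<Sum>j\<le>N. ind_diff S S' j * tangent_map u ^ j))\<^sup>2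
      \<le> 4 * (real (card S))\<^sup>2 * exp (20 * s) ^ N * h2"
    unfolding h2_def using s p S S' card_eq by (intro norm_sum_ind_diff_le) auto
  also have "\<dots> = exp (20 * (s * real N)) * (4 * (real (card S))\<^sup>2 * h2)"
    by (simp add: mult_ac flip: exp_of_nat_mult)
  finally have up: "(1 / 64) ^ n * (1 - y) ^ N \<le> exp (20 * (s * real N)) * (4 * (real (card S))\<^sup>2 * h2)"
    using A by linarith
  have "exp (-50 * L) \<le> exp (- 5 * real n)"
    using n by simp
  also have "\<dots> = exp (- 5) ^ n"
    by (simp add: mult.commute flip: exp_of_nat_mult)
  also have "\<dots> \<le> (1 / 64) ^ n"
  proof (rule power_mono)
    have "64 \<le> (5 / 4 :: real) ^ 20"
      by (simp add: power_divide)
    also have "\<dots> \<le> exp (1 / 4) ^ 20"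
      using exp_ge_add_one_self[of "1 / 4"] by (intro power_mono) auto
    also have "\<dots> = exp (5::real)"
      by (simp flip: exp_of_nat_mult)
    finally have "64 \<le> exp (5::real)" .
    then show "exp (- 5) \<le> (1 / 64 :: real)"
      by (simp add: exp_minus field_simps)
  qed simp
  finally have e1: "exp (-50 * L) \<le> (1 / 64) ^ n" .
  have "exp (- L) \<le> exp (- 2 * (s * real N))"
    using s(3) L_ge_1 by simp
  also have "\<dots> \<le> exp (- 2 * y) ^ N"
    using ys by (simp add: mult_right_mono mult_ac flip: exp_of_nat_mult)
  also have "\<dots> \<le> (1 - y) ^ N"
    using y ys s by (intro power_mono one_minus_ge_exp) auto
  finally have e2: "exp (- L) \<le> (1 - y) ^ N" .
  have "exp (- 51 * L) = exp (-50 * L) * exp (- L)"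
    by (simp flip: exp_add)
  also have "\<dots> \<le> (1 / 64) ^ n * (1 - y) ^ N"
    using e1 e2 by (intro mult_mono) auto
  also note up
  also have "exp (20 * (s * real N)) * (4 * (real (card S))\<^sup>2 * h2) \<le> exp L * (4 * (real (card S))\<^sup>2 * h2)"
  proof (rule mult_right_mono)
    \<comment> \<open>The sign of \<open>h2\<close> is read off from the chain itself, whose left
      end is a positive exponential.\<close>
    have "0 < exp (20 * (s * real N)) * (4 * (real (card S))\<^sup>2 * h2)"
      using \<open>exp (- 51 * L) = exp (-50 * L) * exp (- L)\<close> up calculation by (smt (verit) exp_gt_zero)
    then show "0 \<le> 4 * (real (card S))\<^sup>2 * h2"
      by (simp add: zero_less_mult_iff)
    show "exp (20 * (s * real N)) \<le> exp L"
      using s(3) L_ge_1 by simp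
  qed
  finally have "exp (- L) * exp (- 51 * L) \<le> exp (- L) * (exp L * (4 * (real (card S))\<^sup>2 * h2))"
    by (intro mult_left_mono) auto
  then show ?thesis
    by (simp add: mult.assoc[symmetric] flip: exp_add)
qed

lemma N_ge_2: "2 \<le> N"
proof (rule ccontr)
  assume "\<not> 2 \<le> N"
  then have "S \<subseteq> {1}" "S' \<subseteq> {1}"
    using S S' by (auto simp: not_le)
  then show False
    using S S' neq by (auto simp: subset_singleton_iff)
qed

text \<open>The second moment may diverge at the point \<open>z\<close> of the large value. So the
  polynomial \<open>Q\<close> is bounded by the Hellinger distance on a circle where the moment is
  under control, and extrapolation carries this bound to \<open>z\<close>.\<close>

lemma hellinger_small_p:
  assumes small: "(real N)\<^sup>2 * p < 1"
  shows "exp (- 52 * L) \<le> 4 * (real (card S))\<^sup>2 * h2"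
proof -
  \<comment> \<open>With \<open>p * R\<^sup>2 = 1 / 4\<close> the base of the second moment is at
    most 4/3 on \<open>norm z = R\<close>, and \<open>p * R \<le> 1 / 4\<close> keeps
    \<open>1 - p z\<close> away from 0.\<close>
  define R where "R = 1 / (2 * sqrt p)"
  define K where "K = 4 * (real (card S))\<^sup>2 * h2"
  define A where "A w = (\<Sum>j\<le>N. ind_diff S S' j * w ^ j)" for w :: complex
  \<comment> \<open>\<open>Q z = (1 - p z) ^ N * A w\<close>, which is a polynomial in \<open>z\<close> of degree at most \<open>N\<close>.\<close>
  define Q where "Q = (\<Sum>j\<le>N. smult (ind_diff S S' j * of_real (1 - p) ^ j) ([:1, - of_real p:] ^ (N - j)))"
  have N: "real N \<ge> 2"
    using N_ge_2 by simp
  have "p * 4 \<le> p * (real N)\<^sup>2"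
    using p power_mono[OF N, of 2] by (intro mult_left_mono) auto
  then have p4: "p \<le> 1 / 4"
    using small by (simp add: mult.commute)
  have R: "0 < R" "p * R\<^sup>2 = 1 / 4" "p * R \<le> 1 / 4"
  proof -
    show "0 < R"
      using p by (simp add: R_def)
    show "p * R\<^sup>2 = 1 / 4"
      using p by (simp add: R_def power_divide power_mult_distrib)
    have "p * R = sqrt p / 2"
      using p by (simp add: R_def real_div_sqrt field_simps)
    moreover have "sqrt p \<le> 1 / 2"
      using p4 p by (intro real_le_lsqrt) (auto simp: power_divide)
    ultimately show "p * R \<le> 1 / 4"
      by simp
  qed
  have Q_eq: "poly Q z = (1 - of_real p * z) ^ N * A (of_real (1 - p) / (1 - of_real p * z))"
    if "1 - of_real p * z \<noteq> 0" for z
  proof -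
    have "(1 - of_real p * z) ^ (N - j) = (1 - of_real p * z) ^ N / (1 - of_real p * z) ^ j" if "j \<le> N" for j
      using \<open>1 - of_real p * z \<noteq> 0\<close> that by (simp add: power_diff)
    then show ?thesis
      by (simp add: Q_def A_def poly_sum poly_power sum_distrib_left power_divide mult_ac)
  qed
  have degQ: "degree Q \<le> N"
    unfolding Q_def
  proof (rule degree_sum_le)
    fix j
    have "degree ([:1, - complex_of_real p:] ^ (N - j)) \<le> degree [:1, - complex_of_real p:] * (N - j)"
      by (rule degree_power_le)
    also have "\<dots> \<le> 1 * N"
      by (intro mult_mono) auto
    finally show "degree (smult (ind_diff S S' j * of_real (1 - p) ^ j) ([:1, - of_real p:] ^ (N - j))) \<le> N"
      using degree_smult_le order_trans by fastforce
  qed simp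
  have Q_le: "(norm (poly Q z))\<^sup>2 \<le> 4 ^ N * K" if z: "norm z = R" for z
  proof -
    have "norm (of_real p * z) \<le> 1 / 4"
      using R z p by (simp add: norm_mult)
    then have pz: "norm (1 - of_real p * z) \<le> 5 / 4" "1 - of_real p * z \<noteq> 0"
      using norm_triangle_ineq4[of 1 "of_real p * z"] by auto
    have pR: "p * (norm z)\<^sup>2 = 1 / 4"
      using R z by simp
    have "(1 - p) / (1 - p * (norm z)\<^sup>2) \<le> 4 / 3"
      unfolding pR using p by simp
    with pR have "(norm (A (of_real (1 - p) / (1 - of_real p * z))))\<^sup>2 \<le> 4 * (real (card S))\<^sup>2 * (4 / 3) ^ N * h2"
      unfolding A_def h2_def using p S S' card_eq by (intro norm_sum_ind_diff_le[of _ _ _ _ z]) simp_all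
    also have "\<dots> = (4 / 3) ^ N * K"
      by (simp add: K_def)
    finally have A_le: "(norm (A (of_real (1 - p) / (1 - of_real p * z))))\<^sup>2 \<le> (4 / 3) ^ N * K" .
    then have "((norm (1 - of_real p * z))\<^sup>2) ^ N * (norm (A (of_real (1 - p) / (1 - of_real p * z))))\<^sup>2
        \<le> ((5 / 4)\<^sup>2) ^ N * ((4 / 3) ^ N * K)"
      using pz by (intro mult_mono power_mono) (auto)
    also have "\<dots> = ((5 / 4)\<^sup>2 * (4 / 3)) ^ N * K"
      by (simp only: power_mult_distrib mult.assoc)
    also have "\<dots> \<le> 4 ^ N * K"
    proof (intro mult_right_mono power_mono)
      have "0 \<le> (4 / 3) ^ N * K"
        using A_le by (rule order_trans[rotated]) simp
      then show "0 \<le> K"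
        by (intro mult_left_le_imp_le[of "(4 / 3) ^ N" 0 K]) auto
    qed (auto simp: power_divide)
    finally show ?thesis
      using pz by (simp add: Q_eq norm_mult norm_power power_mult_distrib power_commutes mult.commute flip: power_mult)
  qed
  have "K \<ge> 0"
  proof -
    have "0 \<le> 4 ^ N * K"
      using R by (intro order_trans[OF _ Q_le[of "of_real R"]]) auto
    then show ?thesis
      by (intro mult_left_le_imp_le[of "4 ^ N" 0 K]) auto
  qed
  define M where "M = sqrt (4 ^ N * K)"
  have M: "norm (poly Q z) \<le> M" if "norm z = R" for z
    unfolding M_def using Q_le[OF that] by (rule real_le_rsqrt)
  \<comment> \<open>\<open>X * R = 2 / (N * p)\<close> will bound \<open>norm z\<close>, so
    extrapolation beyond radius \<open>R\<close> loses at most the factor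
    \<open>X ^ N\<close>.\<close>
  define X where "X = 4 / (real N * sqrt p)"
  have Np: "real N * sqrt p \<le> 1" "0 < real N * sqrt p" "real N * p \<le> 1"
  proof -
    have "(real N * sqrt p)\<^sup>2 \<le> 1\<^sup>2"
      using small p by (simp add: power_mult_distrib)
    then show "real N * sqrt p \<le> 1"
      by (rule power2_le_imp_le) simp
    show "0 < real N * sqrt p"
      using N p by simp
    have "real N * p * 1 \<le> real N * p * real N"
      using N p by (intro mult_left_mono) auto
    then show "real N * p \<le> 1"
      using small by (simp add: power2_eq_square mult_ac)
  qed
  have "1 \<le> X"
    using Np by (simp add: X_def field_simps)
  \<comment> \<open>The choice \<open>4 * N\<close> gives \<open>N\<^sup>2 * y \<le> 1 / 4\<close>,
    whence \<open>(N * p * norm z)\<^sup>2 \<le> 1 + 10 / 4 \<le> 4\<close>.\<close>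
  obtain u y where u: "norm u = 1" and y: "y = (1 - Re u) / 2" "0 \<le> y" "y \<le> 4 / (real (4 * N))\<^sup>2"
    and w2: "(norm (tangent_map u))\<^sup>2 = 1 - y"
    and Au: "(1 / 64) ^ (4 * N) * (1 - y) ^ N \<le> (norm (\<Sum>j\<le>N. ind_diff S S' j * tangent_map u ^ j))\<^sup>2"
    by (rule ex_large_ind_diff[of "4 * N"]) (use N_ge_1 in auto)
  have y2: "y \<le> 1 / (4 * (real N)\<^sup>2)"
    using y(3) by (simp add: power_mult_distrib)
  also have "\<dots> \<le> 1 / (4 * 2\<^sup>2)"
    using N by (intro divide_left_mono mult_left_mono power_mono) auto
  finally have y16: "y \<le> 1 / 16"
    by simp
  define z where "z = (1 - of_real (1 - p) / tangent_map u) / of_real p"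
  have "tangent_map u \<noteq> 0"
    using w2 y16 by auto
  have pz: "1 - of_real p * z = of_real (1 - p) / tangent_map u"
    using p by (simp add: z_def)
  have z_le: "norm z \<le> X * R"
  proof -
    have "p\<^sup>2 * (norm z)\<^sup>2 \<le> p\<^sup>2 + 10 * (1 - p) * y"
      using y16 by (intro norm_tangent_map_preimage_le[OF u y(1) _ p z_def]) auto
    also have "10 * (1 - p) * y \<le> 10 * 1 * y"
      using p y by (intro mult_right_mono mult_left_mono) auto
    finally have "(real N)\<^sup>2 * (p\<^sup>2 * (norm z)\<^sup>2) \<le> (real N)\<^sup>2 * (p\<^sup>2 + 10 * y)"
      by (intro mult_left_mono) auto
    also have "\<dots> = (real N * p)\<^sup>2 + 10 * ((real N)\<^sup>2 * y)"
      by (simp add: algebra_simps)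
    also have "\<dots> \<le> 1\<^sup>2 + 10 * (1 / 4)"
      using Np p y2 N by (intro add_mono power_mono mult_left_mono) (auto simp: field_simps)
    also have "\<dots> \<le> 2\<^sup>2"
      by simp
    finally have "(real N * p * norm z)\<^sup>2 \<le> 2\<^sup>2"
      by (simp add: power_mult_distrib mult.assoc)
    then have "real N * p * norm z \<le> 2"
      by (rule power2_le_imp_le) simp
    then have "norm z \<le> 2 / (real N * p)"
      using N p by (simp add: pos_le_divide_eq mult.commute)
    also have "\<dots> = X * R"
      using p by (simp add: X_def R_def)
    finally show ?thesis .
  qed
  have "norm (poly Q z) \<le> M * X ^ N"
  proof (cases "R \<le> norm z")
    case True
    have "norm (poly Q z) \<le> M * (norm z / R) ^ N"
      using M by (intro poly_norm_extrapolation[OF degQ R(1) True]) auto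
    also have "\<dots> \<le> M * X ^ N"
      using z_le R \<open>0 \<le> K\<close> by (intro mult_left_mono power_mono) (auto simp: M_def pos_divide_le_eq)
    finally show ?thesis .
  next
    case False
    have "norm (poly Q z) \<le> M"
    proof (rule norm_le_of_norm_le_on_circle[OF _ R(1) M])
      show "poly Q holomorphic_on UNIV"
        by (intro holomorphic_intros)
    qed (use False in auto)
    also have "M * 1 \<le> M * X ^ N"
      using \<open>1 \<le> X\<close> \<open>0 \<le> K\<close> by (intro mult_left_mono) (auto simp: M_def)
    finally show ?thesis by simp
  qed
  then have "(norm (poly Q z))\<^sup>2 \<le> (M * X ^ N)\<^sup>2"
    by (intro power_mono) auto
  also have "\<dots> = 4 ^ N * K * (X\<^sup>2) ^ N"
    using \<open>0 \<le> K\<close> by (simp add: M_def power_mult_distrib mult.commute flip: power_mult)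
  also have "X\<^sup>2 = 16 / ((real N)\<^sup>2 * p)"
    using p by (simp add: X_def power_divide power_mult_distrib)
  finally have up: "(norm (poly Q z))\<^sup>2 \<le> 4 ^ N * K * (16 / ((real N)\<^sup>2 * p)) ^ N" .
  have "(1 / 2) ^ N * ((1 / 64) ^ (4 * N) * (1 / 2) ^ N) \<le> ((norm (1 - of_real p * z))\<^sup>2) ^ N * (norm (A (tangent_map u)))\<^sup>2"
  proof (rule mult_mono)
    have "1 - y \<le> 1"
      using y by simp
    have "(1 / 2 :: real) \<le> (3 / 4)\<^sup>2 / 1"
      by (simp add: power_divide)
    also have "\<dots> \<le> (1 - p)\<^sup>2 / (1 - y)"
      using p4 y y16 by (intro frac_le power_mono) auto
    also have "\<dots> = (norm (1 - of_real p * z))\<^sup>2"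
      using p by (simp add: pz norm_divide power_divide w2 del: of_real_diff)
    finally show "(1 / 2) ^ N \<le> ((norm (1 - of_real p * z))\<^sup>2) ^ N"
      by (intro power_mono) auto
    have "(1 / 64) ^ (4 * N) * (1 / 2) ^ N \<le> (1 / 64 :: real) ^ (4 * N) * (1 - y) ^ N"
      using y16 by (intro mult_left_mono power_mono) auto
    then show "(1 / 64) ^ (4 * N) * (1 / 2) ^ N \<le> (norm (A (tangent_map u)))\<^sup>2"
      using Au unfolding A_def by (rule order_trans)
  qed auto
  also have "\<dots> = (norm (poly Q z))\<^sup>2"
  proof -
    have "tangent_map u = of_real (1 - p) / (1 - of_real p * z)" "1 - of_real p * z \<noteq> 0"
      unfolding pz using \<open>tangent_map u \<noteq> 0\<close> p by auto
    then show ?thesis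
      by (simp add: Q_eq norm_mult norm_power power_mult_distrib mult.commute flip: power_mult)
  qed
  also note up
  finally have "(1 / 2) ^ N * ((1 / 64) ^ (4 * N) * (1 / 2) ^ N) \<le> 4 ^ N * K * (16 / ((real N)\<^sup>2 * p)) ^ N" .
  \<comment> \<open>The exponent is 26 = 1 + 4 * 6 + 1; moving the factor 4 * 16 = 2 ^ 6 across then
    gives 32.\<close>
  moreover have "(1 / 2) ^ N * ((1 / 64) ^ (4 * N) * (1 / 2) ^ N) = (1 / 2 ^ 26 :: real) ^ N"
    unfolding power_mult power_mult_distrib[symmetric] by (simp add: power_divide)
  ultimately have "(1 / 2 ^ 26) ^ N \<le> K * (64 / ((real N)\<^sup>2 * p)) ^ N"
    by (simp add: power_divide power_mult_distrib[symmetric] mult_ac)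
  then have "(1 / 2 ^ 26) ^ N * (((real N)\<^sup>2 * p) / 64) ^ N
      \<le> K * (64 / ((real N)\<^sup>2 * p)) ^ N * (((real N)\<^sup>2 * p) / 64) ^ N"
    using p by (intro mult_right_mono) auto
  also have "\<dots> = K * (64 / ((real N)\<^sup>2 * p) * (((real N)\<^sup>2 * p) / 64)) ^ N"
    by (simp only: power_mult_distrib mult.assoc)
  also have "\<dots> = K"
    using p N by simp
  finally have K: "(1 / 2 ^ 32) ^ N * ((real N)\<^sup>2 * p) ^ N \<le> K"
    unfolding power_mult_distrib[symmetric] by simp
  \<comment> \<open>Since \<open>N\<^sup>2 * p = 1 / s ^ 3\<close> with \<open>s \<ge> 1\<close>,
    the inequality \<open>s \<le> exp s\<close> bounds the extrapolation loss
    \<open>(1 / (N\<^sup>2 * p)) ^ N\<close> by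
    \<open>exp (3 * s * N) = exp (3 * L)\<close>.\<close>
  define s where "s = L / real N"
  have s3: "s ^ 3 = 1 / ((real N)\<^sup>2 * p)"
    unfolding s_def power_divide L_cubed using N p by (simp add: power2_eq_square power3_eq_cube)
  have "1 ^ 3 \<le> s ^ 3"
    unfolding s3 using small p N by (simp add: field_simps)
  moreover have "0 \<le> s"
    using L_ge_1 by (simp add: s_def)
  ultimately have s1: "1 \<le> s"
    using power_mono_iff[of 1 s 3] by simp
  then have LN: "real N \<le> L"
    using N by (simp add: s_def field_simps)
  have "exp (- 3 * L) = (exp (- s) ^ 3) ^ N"
    using N by (simp add: s_def flip: exp_of_nat_mult)
  also have "\<dots> \<le> ((1 / s) ^ 3) ^ N"
  proof (intro power_mono)
    have "s \<le> exp s"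
      using exp_ge_add_one_self[of s] by linarith
    then show "exp (- s) \<le> 1 / s"
      using s1 by (simp add: exp_minus field_simps)
  qed auto
  also have "(1 / s) ^ 3 = (real N)\<^sup>2 * p"
    using s3 by (simp add: power_divide)
  finally have e1: "exp (- 3 * L) \<le> ((real N)\<^sup>2 * p) ^ N" .
  have "exp (- 32 * L) \<le> exp (- 32 * real N)"
    using LN by simp
  also have "\<dots> = (exp (- 1) ^ 32) ^ N"
    by (simp flip: exp_of_nat_mult)
  also have "\<dots> \<le> ((1 / 2) ^ 32) ^ N"
  proof (intro power_mono)
    show "exp (- 1) \<le> (1 / 2 :: real)"
      using exp_ge_add_one_self[of 1] by (simp add: exp_minus field_simps)
  qed auto
  finally have e2: "exp (- 32 * L) \<le> (1 / 2 ^ 32) ^ N"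
    by (simp add: power_divide)
  \<comment> \<open>The exponent 35 is weakened to 52 to agree with the other case.\<close>
  have "exp (- 52 * L) \<le> exp (- 32 * L) * exp (- 3 * L)"
    using L_ge_1 by (simp flip: exp_add)
  also have "\<dots> \<le> (1 / 2 ^ 32) ^ N * ((real N)\<^sup>2 * p) ^ N"
    using e1 e2 by (intro mult_mono) auto
  finally show ?thesis
    using K by (simp add: K_def)
qed

text \<open>The factor \<open>4 * (card S)\<^sup>2\<close> costs \<open>exp (8 * L)\<close>:
  \<open>card S \<le> N \<le> L ^ 3 \<le> exp (3 * L)\<close> and
  \<open>4 \<le> exp (2 * L)\<close>.\<close>

lemma hellinger_ge: "exp (- 60 * L) \<le> h2"
proof -
  have card: "0 < card S" "card S \<le> N"
    using S card_mono[of "{1..N}" S] finite_subset[of S "{1..N}"] by (auto simp: card_gt_0_iff)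
  have h: "exp (- 52 * L) \<le> 4 * (real (card S))\<^sup>2 * h2"
    using hellinger_large_N hellinger_small_p by linarith
  then have "0 < 4 * (real (card S))\<^sup>2 * h2"
    using exp_gt_zero less_le_trans by blast
  then have "0 < h2"
    using card by (simp add: zero_less_mult_iff)
  have "real N \<le> real N / p"
    using mult_left_le[of p "real N"] p by (simp add: pos_le_divide_eq)
  also have "\<dots> \<le> exp L ^ 3"
    unfolding L_cubed[symmetric] using L_ge_1 exp_ge_add_one_self[of L] by (intro power_mono) linarith+
  finally have "real (card S) \<le> exp L ^ 3"
    using card by linarith
  then have "(real (card S))\<^sup>2 \<le> (exp L ^ 3)\<^sup>2"
    by (intro power_mono) auto
  moreover have "(2::real) \<le> exp 1"
    using exp_ge_add_one_self[of 1] by simp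
  then have "2 \<le> exp L"
    using L_ge_1 order_trans[of 2 "exp 1" "exp L"] by simp
  then have "2\<^sup>2 \<le> (exp L)\<^sup>2"
    by (intro power_mono) auto
  ultimately have "4 * (real (card S))\<^sup>2 \<le> (exp L)\<^sup>2 * (exp L ^ 3)\<^sup>2"
    by (intro mult_mono) auto
  also have "\<dots> = exp (8 * L)"
    by (simp flip: exp_of_nat_mult exp_add)
  finally have "4 * (real (card S))\<^sup>2 * h2 \<le> exp (8 * L) * h2"
    using \<open>0 < h2\<close> by (intro mult_right_mono) auto
  with h have "exp (- 52 * L) \<le> exp (8 * L) * h2"
    by linarith
  then have "exp (- 8 * L) * exp (- 52 * L) \<le> exp (- 8 * L) * (exp (8 * L) * h2)"
    by (intro mult_left_mono) auto
  then show ?thesis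
    by (simp add: mult.assoc[symmetric] flip: exp_add)
qed

text \<open>The coefficient equals \<open>1 - h2 / 2\<close>, and
  \<open>1 + x \<le> exp x\<close>.\<close>

lemma bhattacharyya_le: "bhattacharyya (NB_mixture p S) (NB_mixture p S') \<le> exp (- exp (- 60 * L) / 2)"
  using hellinger_ge exp_ge_add_one_self[of "- exp (- 60 * L) / 2"] by (simp add: h2_def)

end

section \<open>Sample complexity of the maximum likelihood estimator\<close>

theorem mainTheorem8:
  shows "\<forall>\<delta>::real. 0 < \<delta> \<and> \<delta> < 1 \<longrightarrow>
    (\<exists>C::real. C > 0 \<and>
      (\<forall>(N::nat) (k::nat) (p::real). 1 \<le> N \<and> 1 \<le> k \<and> 0 < p \<and> p < 1 \<longrightarrow>
        (\<forall>m::nat. real m \<ge> exp (C * (real N / p) powr (1 / 3)) \<longrightarrow>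
          (\<exists>estimator :: nat list \<Rightarrow> nat set.
            \<forall>r :: nat \<Rightarrow> nat. inj_on r {1..k} \<and> r ` {1..k} \<subseteq> {1..N} \<longrightarrow>
              measure_pmf.prob (replicate_pmf m (uniform_mixture k (\<lambda>i. NB (r i) p)))
                {xs. estimator xs = r ` {1..k}} \<ge> 1 - \<delta>))))"
proof (intro allI impI)
  fix \<delta> :: real
  assume "0 < \<delta> \<and> \<delta> < 1"
  then have \<delta>: "0 < \<delta>" "\<delta> < 1"
    by auto
  define D where "D = ln (1 / \<delta>)"
  \<comment> \<open>The union bound asks for \<open>N + D \<le> exp (- 60 * L) * m / 2\<close>. Of
    the 63, 60 cancels \<open>exp (- 60 * L)\<close> and 3 pays for
    \<open>N \<le> exp (3 * L)\<close>; the logarithm pays for \<open>2 * (1 + D)\<close>, using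
    \<open>L \<ge> 1\<close>.\<close>
  define C where "C = 63 + ln (2 + 2 * D)"
  have "0 < D"
    using \<delta> by (simp add: D_def)
  then have "0 < ln (2 + 2 * D)"
    by simp
  show "\<exists>C::real. C > 0 \<and>
      (\<forall>(N::nat) (k::nat) (p::real). 1 \<le> N \<and> 1 \<le> k \<and> 0 < p \<and> p < 1 \<longrightarrow>
        (\<forall>m::nat. real m \<ge> exp (C * (real N / p) powr (1 / 3)) \<longrightarrow>
          (\<exists>estimator :: nat list \<Rightarrow> nat set.
            \<forall>r :: nat \<Rightarrow> nat. inj_on r {1..k} \<and> r ` {1..k} \<subseteq> {1..N} \<longrightarrow>
              measure_pmf.prob (replicate_pmf m (uniform_mixture k (\<lambda>i. NB (r i) p)))
                {xs. estimator xs = r ` {1..k}} \<ge> 1 - \<delta>)))"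
  proof (intro exI[of _ C] conjI allI impI)
    show "0 < C"
      using \<open>0 < ln (2 + 2 * D)\<close> by (simp add: C_def)
    fix N k :: nat and p :: real and m :: nat
    assume "1 \<le> N \<and> 1 \<le> k \<and> 0 < p \<and> p < 1"
    then have N: "1 \<le> N" and k: "1 \<le> k" and p: "0 < p" "p < 1"
      by auto
    define L where L_eq: "L = (real N / p) powr (1 / 3)"
    assume "exp (C * (real N / p) powr (1 / 3)) \<le> real m"
    then have m: "exp (C * L) \<le> real m"
      by (simp add: L_eq)
    define \<beta> where "\<beta> = exp (- exp (- 60 * L) / 2)"
    \<comment> \<open>For \<open>k > N\<close> this is empty, and then no admissible
      \<open>r\<close> exists either.\<close>
    define H where "H = {S. S \<subseteq> {1..N} \<and> card S = k}"
    have "finite H"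
      unfolding H_def by (rule finite_subset[of _ "Pow {1..N}"]) auto
    obtain est :: "nat list \<Rightarrow> nat set" where est:
      "\<And>m \<beta> S. S \<in> H \<Longrightarrow> 0 \<le> \<beta> \<Longrightarrow>
        (\<And>S'. S' \<in> H \<Longrightarrow> S' \<noteq> S \<Longrightarrow> bhattacharyya (NB_mixture p S) (NB_mixture p S') \<le> \<beta>) \<Longrightarrow>
        1 - real (card H) * \<beta> ^ m \<le> measure_pmf.prob (replicate_pmf m (NB_mixture p S)) {xs. est xs = S}"
      using ex_maximum_likelihood_estimator[OF \<open>finite H\<close>, of "NB_mixture p"] by blast
    have error: "real (card H) * \<beta> ^ m \<le> \<delta>"
    proof -
      have "p \<le> real N"
        using N p by linarith
      then have "1 \<le> real N / p"
        using p by simp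
      then have L: "1 \<le> L" "L ^ 3 = real N / p"
        unfolding L_eq by (auto simp: powr_third_cubed intro!: ge_one_powr_ge_zero)
      have "real N \<le> real N / p"
        using mult_left_le[of p "real N"] p by (simp add: pos_le_divide_eq)
      also have "\<dots> \<le> exp L ^ 3"
        unfolding L(2)[symmetric] using L exp_ge_add_one_self[of L] by (intro power_mono) linarith+
      finally have "real N \<le> exp L ^ 3" .
      moreover have "1 * D \<le> exp L ^ 3 * D"
        using L \<open>0 < D\<close> by (intro mult_right_mono one_le_power) auto
      ultimately have "real N + D \<le> exp L ^ 3 * (1 + D)"
        unfolding distrib_left by linarith
      also have "\<dots> = exp (3 * L) * exp (ln (2 + 2 * D)) / 2"
        using \<open>0 < D\<close> by (simp add: algebra_simps flip: exp_of_nat_mult)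
      also have "\<dots> \<le> exp (3 * L) * exp (ln (2 + 2 * D) * L) / 2"
        using L \<open>0 < ln (2 + 2 * D)\<close> by (intro divide_right_mono mult_left_mono) auto
      also have "\<dots> = exp (- 60 * L) * exp (C * L) / 2"
        by (simp add: C_def algebra_simps flip: exp_add)
      also have "\<dots> \<le> exp (- 60 * L) * real m / 2"
        using m by (intro divide_right_mono mult_left_mono) auto
      finally have ND: "real N + D \<le> exp (- 60 * L) * real m / 2" .
      have "card H \<le> card (Pow {1..N})"
        unfolding H_def by (intro card_mono) auto
      then have "real (card H) \<le> 2 ^ N"
        by (simp add: card_Pow flip: of_nat_power)
      also have "\<dots> \<le> exp 1 ^ N"
        using exp_ge_add_one_self[of 1] by (intro power_mono) auto
      finally have "real (card H) * \<beta> ^ m \<le> exp (real N) * exp (- (exp (- 60 * L) * real m / 2))"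
        unfolding \<beta>_def by (intro mult_mono) (auto simp: mult_ac simp flip: exp_of_nat_mult)
      also have "\<dots> \<le> exp (- D)"
        using ND by (simp flip: exp_add)
      also have "\<dots> = \<delta>"
        using \<delta> by (simp add: D_def ln_div)
      finally show ?thesis .
    qed
    show "\<exists>estimator :: nat list \<Rightarrow> nat set.
            \<forall>r :: nat \<Rightarrow> nat. inj_on r {1..k} \<and> r ` {1..k} \<subseteq> {1..N} \<longrightarrow>
              measure_pmf.prob (replicate_pmf m (uniform_mixture k (\<lambda>i. NB (r i) p)))
                {xs. estimator xs = r ` {1..k}} \<ge> 1 - \<delta>"
    proof (intro exI[of _ est] allI impI)
      fix r :: "nat \<Rightarrow> nat"
      assume "inj_on r {1..k} \<and> r ` {1..k} \<subseteq> {1..N}"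
      then have r: "inj_on r {1..k}" "r ` {1..k} \<subseteq> {1..N}"
        by auto
      define S where "S = r ` {1..k}"
      have "S \<in> H"
        using r by (simp add: H_def S_def card_image)
      moreover have "bhattacharyya (NB_mixture p S) (NB_mixture p S') \<le> \<beta>" if "S' \<in> H" "S' \<noteq> S" for S'
      proof -
        interpret distinct_mixtures N p S S'
          using that \<open>S \<in> H\<close> k p by unfold_locales (auto simp: H_def)
        show ?thesis
          using bhattacharyya_le by (simp add: \<beta>_def L_eq L_def)
      qed
      ultimately have "1 - real (card H) * \<beta> ^ m
          \<le> measure_pmf.prob (replicate_pmf m (NB_mixture p S)) {xs. est xs = S}"
        by (intro est) (auto simp: \<beta>_def)
      then show "1 - \<delta> \<le> measure_pmf.prob (replicate_pmf m (uniform_mixture k (\<lambda>i. NB (r i) p)))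
          {xs. est xs = r ` {1..k}}"
        using error uniform_mixture_NB[OF k r(1), of p] by (simp add: S_def)
    qed
  qed
qed

end
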